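(* Let $G$ be a finite group and let $\mathcal{T}=(G,A,B)$ be a nontrivial triple factorisation. Then $$|G|\leq\frac{|A|^2|B|}{|A\cap B|^2}-\frac{|A|\cdot|B|}{|A\cap B|}+|B|,$$ with equality if and only if $G$ (acting by right multiplication on $\Omega_B$) is a flag-transitive collineation group of a projective plane with point set $\Omega_B$ and having the $A$-orbit containing the coset $B$ as a line.
   Context: All groups are finite. A triple factorisation $\mathcal{T}=(G,A,B)$ consists of a group $G$ and subgroups $A,B\leq G$ such that $G=ABA=\{abc : a,c\in A,\ b\in B\}$. It is trivial if $A=G$ or $B=G$, and nontrivial otherwise. $\Omega_B=\{Bg : g\in G\}$ is the set of right cosets of $B$ in $G$, on which $G$ acts by right multiplication (not necessarily faithfully); the $A$-orbit containing the coset $B$ is $\{Ba : a\in A\}$. A projective plane is understood here as a symmetric $2$-$(k^2-k+1,k,1)$ design with $k\ge 2$ (a set of $k^2-k+1$ points and a set of $k^2-k+1$ $k$-element subsets called lines such that each pair of distinct points lies in exactly one line); thus the triangle ($k=2$) is allowed. A collineation group is a group acting on points and mapping lines to lines; it is flag-transitive if it is transitive on incident point-line pairs. *)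

theory Defs
  imports Complex_Main "HOL-Algebra.Coset" "HOL-Algebra.Group_Action"
begin

definition triple_factorisation :: "('a, 'b) monoid_scheme \<Rightarrow> 'a set \<Rightarrow> 'a set \<Rightarrow> bool" where
  "triple_factorisation G A B \<longleftrightarrow>
     group G \<and> subgroup A G \<and> subgroup B G \<and>
     carrier G = {a \<otimes>\<^bsub>G\<^esub> b \<otimes>\<^bsub>G\<^esub> c | a b c. a \<in> A \<and> b \<in> B \<and> c \<in> A}"

definition nontrivial_triple_factorisation ::
  "('a, 'b) monoid_scheme \<Rightarrow> 'a set \<Rightarrow> 'a set \<Rightarrow> bool" where
  "nontrivial_triple_factorisation G A B \<longleftrightarrow>
     triple_factorisation G A B \<and> A \<noteq> carrier G \<and> B \<noteq> carrier G"

text \<open>A symmetric 2-\<open>(k\<^sup>2 - k + 1, k, 1)\<close> design with \<open>k \<ge> 2\<close>; the triangle (\<open>k = 2\<close>) counts as a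
  projective plane. Lines are sets of points, and incidence is membership.\<close>

definition projective_plane :: "'p set \<Rightarrow> 'p set set \<Rightarrow> bool" where
  "projective_plane P L \<longleftrightarrow>
     finite P \<and> finite L \<and>
     (\<exists>k::nat. k \<ge> 2 \<and> card P = k\<^sup>2 - k + 1 \<and> card L = k\<^sup>2 - k + 1 \<and>
        (\<forall>l\<in>L. l \<subseteq> P \<and> card l = k)) \<and>
     (\<forall>p\<in>P. \<forall>q\<in>P. p \<noteq> q \<longrightarrow> (\<exists>!l. l \<in> L \<and> p \<in> l \<and> q \<in> l))"

definition collineation_group ::
  "('a, 'b) monoid_scheme \<Rightarrow> ('a \<Rightarrow> 'p \<Rightarrow> 'p) \<Rightarrow> 'p set \<Rightarrow> 'p set set \<Rightarrow> bool" where
  "collineation_group G \<phi> P L \<longleftrightarrow>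
     group_action G P \<phi> \<and> (\<forall>g\<in>carrier G. \<forall>l\<in>L. \<phi> g ` l \<in> L)"

definition flag_transitive_collineation_group ::
  "('a, 'b) monoid_scheme \<Rightarrow> ('a \<Rightarrow> 'p \<Rightarrow> 'p) \<Rightarrow> 'p set \<Rightarrow> 'p set set \<Rightarrow> bool" where
  "flag_transitive_collineation_group G \<phi> P L \<longleftrightarrow>
     collineation_group G \<phi> P L \<and>
     (\<forall>p\<in>P. \<forall>l\<in>L. \<forall>q\<in>P. \<forall>m\<in>L. p \<in> l \<longrightarrow> q \<in> m \<longrightarrow>
        (\<exists>g\<in>carrier G. \<phi> g p = q \<and> \<phi> g ` l = m))"

text \<open>Actions in \<^locale>\<open>group_action\<close> are left actions, so the right action \<open>Bx \<mapsto> Bxg\<close> on the right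
  cosets of \<open>B\<close> is given as the corresponding left action \<open>g \<mapsto> (Bx \<mapsto> Bxg\<^sup>-\<^sup>1)\<close>; both consist of
  the same permutations. The restriction is because permutations in \<^const>\<open>BijGroup\<close> are extensional.\<close>

definition right_mult_action :: "('a, 'b) monoid_scheme \<Rightarrow> 'a set \<Rightarrow> 'a \<Rightarrow> 'a set \<Rightarrow> 'a set" where
  "right_mult_action G B g = (\<lambda>X\<in>rcosets\<^bsub>G\<^esub> B. X #>\<^bsub>G\<^esub> inv\<^bsub>G\<^esub> g)"

lemma group_action_right_mult_action:
  assumes "group G" "subgroup B G"
  shows "group_action G (rcosets\<^bsub>G\<^esub> B) (right_mult_action G B)"
proof -
  interpret group G by fact
  have BG: "B \<subseteq> carrier G" using assms(2) by (rule subgroup.subset)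
  have step: "X #>\<^bsub>G\<^esub> g \<in> rcosets\<^bsub>G\<^esub> B" if "X \<in> rcosets\<^bsub>G\<^esub> B" "g \<in> carrier G" for X g
    using that BG by (auto simp: RCOSETS_def coset_mult_assoc)
  have sub: "X \<subseteq> carrier G" if "X \<in> rcosets\<^bsub>G\<^esub> B" for X
    using that BG by (auto simp: RCOSETS_def r_coset_def)
  have bij: "right_mult_action G B g \<in> Bij (rcosets\<^bsub>G\<^esub> B)" if g: "g \<in> carrier G" for g
  proof -
    have "bij_betw (\<lambda>X. X #>\<^bsub>G\<^esub> inv\<^bsub>G\<^esub> g) (rcosets\<^bsub>G\<^esub> B) (rcosets\<^bsub>G\<^esub> B)"
      by (rule bij_betw_byWitness[where f' = "\<lambda>X. X #>\<^bsub>G\<^esub> g"])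
         (use g step sub in \<open>auto simp: coset_mult_assoc\<close>)
    then show ?thesis
      by (auto simp: Bij_def right_mult_action_def bij_betw_restrict_eq)
  qed
  have "right_mult_action G B (g \<otimes>\<^bsub>G\<^esub> h) =
      compose (rcosets\<^bsub>G\<^esub> B) (right_mult_action G B g) (right_mult_action G B h)"
    if "g \<in> carrier G" "h \<in> carrier G" for g h
    using that step sub
    by (auto simp: right_mult_action_def compose_def fun_eq_iff restrict_def
        coset_mult_assoc inv_mult_group)
  then show ?thesis
    using bij by (auto simp: group_action_def group_hom_def group_hom_axioms_def hom_def
        BijGroup_def assms(1) group_BijGroup[unfolded BijGroup_def])
qed

end

theory Submission
  imports Defs
begin

text \<open>Let \<open>G\<close> act on the right cosets of \<open>B\<close>, written as a left action, let \<open>\<Delta>\<close> be the \<open>A\<close>-orbit of the coset \<open>B\<close>, and put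
  \<open>v = |G : B|\<close> and \<open>k = |\<Delta>| = |A| / |A \<inter> B|\<close>. Divided by \<open>|B|\<close>, the claimed inequality reads
  \<open>v \<le> k\<^sup>2 - k + 1\<close>. The factorisation \<open>G = ABA\<close> says exactly that any two translates of \<open>\<Delta>\<close> under
  \<open>G\<close> meet: if \<open>g\<^sup>-\<^sup>1h = abc\<close> with \<open>a, c \<in> A\<close> and \<open>b\<close> fixing the base point \<open>x\<close>, then
  \<open>hc\<^sup>-\<^sup>1x = gax\<close> lies in both translates. So the theorem is about a \<open>k\<close>-uniform intersecting
  family that covers all points equally often, by transitivity.

  For such a family the bound comes from a double count. If the number of sets is at most the
  number of points, counting the pairs of sets with their intersections is enough. There may
  however be many more translates than points. The family is therefore thinned out first, with
  weights: equal weights on the translates, scaled so that every point gets total weight \<open>1\<close>, form a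
  perfect fractional matching, and linear algebra makes its support \<open>S\<close> no larger than \<open>v\<close>
  (\<open>perfect_fractional_matching_sparse\<close>). The weighted count over \<open>S\<close> then gives
  \<open>v \<le> k\<^sup>2 - k + 1\<close> (\<open>intersecting_family_bound\<close>).

  In the case of equality every estimate is sharp: \<open>|S| = v\<close>, two members of \<open>S\<close> meet in exactly one
  point, and each point lies on exactly \<open>k\<close> members; hence \<open>S\<close> is a projective plane. Any further
  translate is a \<open>k\<close>-set meeting all lines of that plane, and such a set is itself a line
  (\<open>blocking_set_is_line\<close>), so the translates are precisely the lines. The group is flag-transitive
  because \<open>G\<close> permutes the translates of \<open>\<Delta>\<close> transitively and \<open>A\<close> fixes \<open>\<Delta>\<close> and is transitive on its
  points. Conversely, if \<open>\<Delta>\<close> is a line of a projective plane on the cosets, then the line size is \<open>k\<close>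
  and \<open>v = k\<^sup>2 - k + 1\<close>.\<close>

section \<open>Sparse perfect fractional matchings\<close>

text \<open>Gaussian elimination, one equation at a time. It serves below for incidence matrices, whose
  rows are points and whose columns are sets of points.\<close>

lemma homogeneous_system_nontrivial_solution:
  fixes M :: "'p \<Rightarrow> 'l \<Rightarrow> real"
  assumes "finite P" "finite S" "card P < card S"
  shows "\<exists>c. (\<exists>l\<in>S. c l \<noteq> 0) \<and> (\<forall>p\<in>P. (\<Sum>l\<in>S. M p l * c l) = 0)"
  using assms
proof (induction P arbitrary: S M rule: finite_induct)
  case empty
  then have "S \<noteq> {}" by auto
  then show ?case by (intro exI[of _ "\<lambda>_. 1"]) auto
next
  case (insert p P)
  show ?case
  proof (cases "\<forall>l\<in>S. M p l = 0")
    case True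
    have "card P < card S" using insert.prems insert.hyps by simp
    from insert.IH[OF insert.prems(1) this, of M] True show ?thesis by auto
  next
    case False
    then obtain s where s: "s \<in> S" "M p s \<noteq> 0" by blast
    define S' where "S' = S - {s}"
    have S': "finite S'" "s \<notin> S'" "S = insert s S'"
      using s insert.prems by (auto simp: S'_def)
    have "card P < card S'" using insert.prems insert.hyps S' by simp
    \<comment> \<open>Equation \<open>p\<close> is solved for the unknown \<open>s\<close> and substituted into the others.\<close>
    from insert.IH[OF S'(1) this, of "\<lambda>q l. M q l - M q s * M p l / M p s"]
    obtain c where c: "\<exists>l\<in>S'. c l \<noteq> 0"
      and c0: "\<And>q. q \<in> P \<Longrightarrow> (\<Sum>l\<in>S'. (M q l - M q s * M p l / M p s) * c l) = 0" by blast
    define T where "T = (\<Sum>l\<in>S'. M p l * c l)"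
    define d where "d = c(s := - T / M p s)"
    have d: "(\<Sum>l\<in>S. M q l * d l) = M q s * (- T / M p s) + (\<Sum>l\<in>S'. M q l * c l)" for q
    proof -
      have "(\<Sum>l\<in>S'. M q l * d l) = (\<Sum>l\<in>S'. M q l * c l)"
        using S'(2) by (intro sum.cong) (auto simp: d_def)
      then show ?thesis using S' by (simp add: d_def)
    qed
    have "(\<Sum>l\<in>S. M q l * d l) = 0" if "q \<in> insert p P" for q
    proof (cases "q = p")
      case True
      then show ?thesis using d[of p] s by (simp add: T_def)
    next
      case False
      then have "q \<in> P" using that by simp
      have "0 = (\<Sum>l\<in>S'. M q l * c l - M q s / M p s * (M p l * c l))"
        using c0[OF \<open>q \<in> P\<close>] by (simp add: algebra_simps)
      also have "\<dots> = (\<Sum>l\<in>S'. M q l * c l) - M q s / M p s * T"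
        by (simp add: T_def sum_subtractf sum_distrib_left)
      finally show ?thesis using d[of q] by simp
    qed
    moreover have "\<exists>l\<in>S. d l \<noteq> 0"
      using c S' by (force simp: d_def)
    ultimately show ?thesis by blast
  qed
qed

definition perfect_fractional_matching :: "'p set \<Rightarrow> 'p set set \<Rightarrow> ('p set \<Rightarrow> real) \<Rightarrow> bool" where
  "perfect_fractional_matching P L w \<longleftrightarrow>
     (\<forall>l\<in>L. 0 \<le> w l) \<and> (\<forall>p\<in>P. (\<Sum>l | l \<in> L \<and> p \<in> l. w l) = 1)"

lemma perfect_fractional_matching_support:
  assumes "finite L" "perfect_fractional_matching P L w"
  shows "perfect_fractional_matching P {l \<in> L. 0 < w l} w"
proof -
  have "(\<Sum>l | l \<in> {l \<in> L. 0 < w l} \<and> p \<in> l. w l) = (\<Sum>l | l \<in> L \<and> p \<in> l. w l)" for p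
    using assms by (intro sum.mono_neutral_left)
      (auto simp: perfect_fractional_matching_def not_less intro: antisym)
  then show ?thesis using assms(2) by (simp add: perfect_fractional_matching_def)
qed

text \<open>With more sets than points the incidence vectors of the sets are linearly dependent. Moving the
  weights along a dependency does not change the total weight at any point, and one stops at the
  first moment when a weight becomes zero.\<close>

lemma perfect_fractional_matching_reduce:
  assumes "finite P" "finite S" "card P < card S"
    and pos: "\<And>l. l \<in> S \<Longrightarrow> 0 < u l" and u: "perfect_fractional_matching P S u"
  obtains S' u' where "S' \<subset> S" "\<And>l. l \<in> S' \<Longrightarrow> 0 < u' l" "perfect_fractional_matching P S' u'"
proof -
  obtain c0 where c0: "\<exists>l\<in>S. c0 l \<noteq> 0"
      "\<And>p. p \<in> P \<Longrightarrow> (\<Sum>l\<in>S. of_bool (p \<in> l) * c0 l) = (0::real)"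
    using homogeneous_system_nontrivial_solution[OF assms(1-3), of "\<lambda>p l. of_bool (p \<in> l)"] by blast
  obtain c where cpos: "\<exists>l\<in>S. 0 < c l"
      and c: "\<And>p. p \<in> P \<Longrightarrow> (\<Sum>l\<in>S. of_bool (p \<in> l) * c l) = (0::real)"
  proof (cases "\<exists>l\<in>S. 0 < c0 l")
    case True
    then show ?thesis using that c0(2) by blast
  next
    case False
    then have "\<exists>l\<in>S. 0 < - c0 l" using c0(1) by force
    moreover have "(\<Sum>l\<in>S. of_bool (p \<in> l) * - c0 l) = 0" if "p \<in> P" for p
      using c0(2)[OF that] by (simp add: sum_negf)
    ultimately show ?thesis using that[of "\<lambda>l. - c0 l"] by blast
  qed
  \<comment> \<open>\<open>t\<close> is the largest step for which all the weights \<open>u l - t * c l\<close> stay nonnegative.\<close>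
  define T where "T = {l \<in> S. 0 < c l}"
  have T: "finite T" "T \<noteq> {}" using assms(2) cpos by (auto simp: T_def)
  define t where "t = Min ((\<lambda>l. u l / c l) ` T)"
  obtain s where s: "s \<in> T" "t = u s / c s"
    using Min_in[of "(\<lambda>l. u l / c l) ` T"] T unfolding t_def by blast
  have t_le: "t \<le> u l / c l" if "l \<in> T" for l
    unfolding t_def using T that by (intro Min_le) auto
  have t0: "0 < t" using s pos by (auto simp: T_def)
  define u' where "u' l = u l - t * c l" for l
  have nonneg: "0 \<le> u' l" if "l \<in> S" for l
  proof (cases "l \<in> T")
    case True
    then show ?thesis using t_le[OF True] by (simp add: u'_def T_def field_simps)
  next
    case False
    then have "t * c l \<le> 0" using that t0 by (simp add: T_def mult_le_0_iff)
    then show ?thesis using pos[OF that] by (simp add: u'_def)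
  qed
  have "(\<Sum>l | l \<in> S \<and> p \<in> l. u' l) = 1" if "p \<in> P" for p
  proof -
    have "(\<Sum>l | l \<in> S \<and> p \<in> l. c l) = 0"
      using c[OF that] assms(2) by (simp add: Int_def)
    then show ?thesis
      using u that by (simp add: u'_def sum_subtractf sum_distrib_left[symmetric]
          perfect_fractional_matching_def)
  qed
  then have "perfect_fractional_matching P S u'"
    using nonneg by (simp add: perfect_fractional_matching_def)
  then have "perfect_fractional_matching P {l \<in> S. 0 < u' l} u'"
    using assms(2) by (rule perfect_fractional_matching_support[rotated])
  moreover have "s \<in> S" "u' s = 0" using s by (auto simp: T_def u'_def)
  then have "{l \<in> S. 0 < u' l} \<subset> S" by (metis (no_types, lifting) less_irrefl mem_Collect_eq psubsetI subsetI)
  ultimately show ?thesis using that by blast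
qed

text \<open>This is the statement that a basic feasible solution of a linear program has at most as many
  nonzero entries as there are equations; a support of minimal cardinality takes its place.\<close>

lemma perfect_fractional_matching_sparse:
  assumes "finite P" "finite L" "perfect_fractional_matching P L w"
  obtains S u where "S \<subseteq> L" "card S \<le> card P" "\<And>l. l \<in> S \<Longrightarrow> 0 < u l"
    "perfect_fractional_matching P S u"
proof -
  define Q where "Q S \<longleftrightarrow> S \<subseteq> L \<and>
    (\<exists>u. (\<forall>l\<in>S. 0 < u l) \<and> perfect_fractional_matching P S u)" for S
  have "Q {l \<in> L. 0 < w l}"
    using perfect_fractional_matching_support[OF assms(2,3)] by (auto simp: Q_def)
  then obtain S where S: "Q S" and min: "\<And>S'. Q S' \<Longrightarrow> card S \<le> card S'"
    using ex_has_least_nat[of Q _ card] by metis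
  obtain u where "S \<subseteq> L" and u: "\<And>l. l \<in> S \<Longrightarrow> 0 < u l" "perfect_fractional_matching P S u"
    using S by (auto simp: Q_def)
  then have fin: "finite S" using assms(2) finite_subset by blast
  have "card S \<le> card P"
  proof (rule ccontr)
    assume "\<not> card S \<le> card P"
    then obtain S' u' where "S' \<subset> S" "\<And>l. l \<in> S' \<Longrightarrow> 0 < u' l" "perfect_fractional_matching P S' u'"
      using perfect_fractional_matching_reduce[OF assms(1) fin _ u] by (metis not_le)
    then have "Q S'" using \<open>S \<subseteq> L\<close> by (auto simp: Q_def)
    moreover have "card S' < card S" using \<open>S' \<subset> S\<close> fin by (rule psubset_card_mono[rotated])
    ultimately show False using min by fastforce
  qed
  then show ?thesis using that \<open>S \<subseteq> L\<close> u by blast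
qed

section \<open>Intersecting families of sets of equal size\<close>

text \<open>Both sides are the total weight of the incidences between points of \<open>m\<close> and members of \<open>S\<close>.\<close>

lemma perfect_fractional_matching_double_count:
  assumes "finite P" "finite S" "perfect_fractional_matching P S u" "m \<subseteq> P"
  shows "(\<Sum>l\<in>S. u l * real (card (m \<inter> l))) = real (card m)"
proof -
  have fin: "finite m" using assms finite_subset by blast
  have "(\<Sum>l\<in>S. u l * real (card (m \<inter> l))) = (\<Sum>l\<in>S. \<Sum>p\<in>m. if p \<in> l then u l else 0)"
    using fin by (simp add: sum.If_cases Int_def mult.commute)
  also have "\<dots> = (\<Sum>p\<in>m. \<Sum>l\<in>S. if p \<in> l then u l else 0)"
    by (rule sum.swap)
  also have "\<dots> = (\<Sum>p\<in>m. \<Sum>l | l \<in> S \<and> p \<in> l. u l)"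
    using assms(2) by (simp add: sum.inter_filter)
  also have "\<dots> = (\<Sum>p\<in>m. 1)"
    using assms(3,4) by (intro sum.cong) (auto simp: perfect_fractional_matching_def)
  finally show ?thesis by simp
qed

lemma perfect_fractional_matching_total_weight:
  assumes "finite P" "finite S" "perfect_fractional_matching P S u"
    and "\<And>l. l \<in> S \<Longrightarrow> l \<subseteq> P \<and> card l = k"
  shows "real k * (\<Sum>l\<in>S. u l) = real (card P)"
proof -
  have "(\<Sum>l\<in>S. u l * real (card (P \<inter> l))) = real k * (\<Sum>l\<in>S. u l)"
    using assms(4) by (simp add: Int_absorb1 sum_distrib_left mult.commute)
  then show ?thesis
    using perfect_fractional_matching_double_count[OF assms(1-3) subset_refl] by simp
qed

text \<open>In an intersecting family the left hand side is a sum of nonnegative terms; it vanishes only if \<open>m\<close>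
  meets every other member of positive weight in a single point. The right hand side singles out the
  contribution of \<open>m\<close> itself, whose intersection with \<open>m\<close> is as large as \<open>k\<close>.\<close>

lemma intersecting_family_excess:
  fixes k :: nat
  assumes "finite P" "finite S" "perfect_fractional_matching P S u"
    and unif: "\<And>l. l \<in> S \<Longrightarrow> l \<subseteq> P \<and> card l = k"
    and "m \<in> S"
  shows "(\<Sum>l\<in>S - {m}. u l * (real (card (m \<inter> l)) - 1)) =
           real k - (\<Sum>l\<in>S. u l) - (real k - 1) * u m"
proof -
  have "real k = (\<Sum>l\<in>S. u l * real (card (m \<inter> l)))"
    using perfect_fractional_matching_double_count[OF assms(1-3)] unif[OF \<open>m \<in> S\<close>] by simp
  also have "\<dots> = (\<Sum>l\<in>S. u l + u l * (real (card (m \<inter> l)) - 1))"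
    by (simp add: algebra_simps)
  also have "\<dots> = (\<Sum>l\<in>S. u l) + (\<Sum>l\<in>S. u l * (real (card (m \<inter> l)) - 1))"
    by (rule sum.distrib)
  also have "(\<Sum>l\<in>S. u l * (real (card (m \<inter> l)) - 1)) =
      u m * (real k - 1) + (\<Sum>l\<in>S - {m}. u l * (real (card (m \<inter> l)) - 1))"
    using sum.remove[OF assms(2) \<open>m \<in> S\<close>, of "\<lambda>l. u l * (real (card (m \<inter> l)) - 1)"] unif[OF \<open>m \<in> S\<close>] by simp
  finally show ?thesis by (simp add: algebra_simps)
qed

text \<open>Summing the excess \<open>e m \<ge> 0\<close> over a sparse support \<open>S\<close> with \<open>s\<close> members and total weight
  \<open>t = v / k\<close> gives \<open>(k - 1) v \<le> s (k\<^sup>2 - v)\<close>. In this inequality the smallness of \<open>S\<close> enters: as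
  \<open>s \<le> v\<close>, it yields \<open>k - 1 \<le> k\<^sup>2 - v\<close>. If equality holds here and
  \<open>k \<ge> 2\<close>, then \<open>s = v\<close> and all excesses are \<open>0\<close>.
  So different members of \<open>S\<close> meet in one point, and the formula for the excess forces all weights
  to be \<open>1 / k\<close>; as the weights at a point add up to \<open>1\<close>, it lies on \<open>k\<close> members.\<close>

lemma intersecting_family_bound:
  fixes k :: nat
  assumes finP: "finite P" and finL: "finite L" and "P \<noteq> {}"
    and unif: "\<And>l. l \<in> L \<Longrightarrow> l \<subseteq> P \<and> card l = k"
    and meet: "\<And>l m. l \<in> L \<Longrightarrow> m \<in> L \<Longrightarrow> l \<inter> m \<noteq> {}"
    and w: "perfect_fractional_matching P L w"
  shows "card P + k \<le> k\<^sup>2 + 1"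
    and "card P + k = k\<^sup>2 + 1 \<Longrightarrow> k \<ge> 2 \<Longrightarrow>
      \<exists>S\<subseteq>L. card S = card P \<and> (\<forall>p\<in>P. card {l \<in> S. p \<in> l} = k) \<and>
        (\<forall>l\<in>S. \<forall>m\<in>S. l \<noteq> m \<longrightarrow> card (l \<inter> m) = 1)"
proof -
  obtain S u where "S \<subseteq> L" and le: "card S \<le> card P"
    and pos: "\<And>l. l \<in> S \<Longrightarrow> 0 < u l" and u: "perfect_fractional_matching P S u"
    using perfect_fractional_matching_sparse[OF finP finL w] by blast
  have fin: "finite S" using \<open>S \<subseteq> L\<close> finL finite_subset by blast
  have uS: "l \<subseteq> P \<and> card l = k" if "l \<in> S" for l using unif that \<open>S \<subseteq> L\<close> by blast
  have "S \<noteq> {}" using u \<open>P \<noteq> {}\<close> by (force simp: perfect_fractional_matching_def)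
  then have s0: "0 < card S" using fin by (simp add: card_gt_0_iff)
  obtain l0 where "l0 \<in> S" using \<open>S \<noteq> {}\<close> by blast
  then have k1: "k \<ge> 1"
    using meet[of l0 l0] uS[of l0] \<open>S \<subseteq> L\<close> finP by (metis Int_absorb One_nat_def Suc_leI card_gt_0_iff finite_subset subsetD)
  define v s t where "v = real (card P)" and "s = real (card S)" and "t = (\<Sum>l\<in>S. u l)"
  define e where "e m = (\<Sum>l\<in>S - {m}. u l * (real (card (m \<inter> l)) - 1))" for m
  have kt: "k * t = v"
    unfolding t_def v_def by (rule perfect_fractional_matching_total_weight[OF finP fin u uS])
  have cm: "1 \<le> card (m \<inter> l)" if "m \<in> S" "l \<in> S" for l m
    using meet[of m l] that \<open>S \<subseteq> L\<close> finP uS by (metis One_nat_def Suc_leI card_gt_0_iff finite_Int finite_subset subsetD)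
  have term0: "0 \<le> u l * (real (card (m \<inter> l)) - 1)" if "m \<in> S" "l \<in> S - {m}" for m l
    using pos[of l] cm[of m l] that by (intro mult_nonneg_nonneg) auto
  have e0: "0 \<le> e m" if "m \<in> S" for m
    unfolding e_def using term0[OF that] by (rule sum_nonneg)
  have e: "e m = k - t - (real k - 1) * u m" if "m \<in> S" for m
    unfolding e_def t_def by (rule intersecting_family_excess[OF finP fin u uS that])
  have "(\<Sum>m\<in>S. e m) = (\<Sum>m\<in>S. (k - t) - (real k - 1) * u m)"
    using e by simp
  also have "\<dots> = s * (k - t) - (real k - 1) * t"
    by (simp add: s_def t_def sum_subtractf sum_distrib_left)
  finally have sum_e: "(\<Sum>m\<in>S. e m) = s * (k - t) - (real k - 1) * t" .
  have "real k * (\<Sum>m\<in>S. e m) = s * (real k * real k - k * t) - (real k - 1) * (k * t)"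
    unfolding sum_e by (simp add: algebra_simps)
  then have total: "real k * (\<Sum>m\<in>S. e m) = s * ((real k)\<^sup>2 - v) - (real k - 1) * v"
    unfolding kt by (simp add: power2_eq_square)
  have sum0: "0 \<le> (\<Sum>m\<in>S. e m)" using e0 by (rule sum_nonneg)
  then have main: "(real k - 1) * v \<le> s * ((real k)\<^sup>2 - v)"
    using total by (metis diff_ge_0_iff_ge mult_nonneg_nonneg of_nat_0_le_iff)
  have sv: "0 < s" "s \<le> v" "0 < v" using s0 le by (auto simp: s_def v_def)
  have "0 \<le> (real k - 1) * v" using k1 sv by simp
  then have "0 \<le> s * ((real k)\<^sup>2 - v)" using main by linarith
  then have "0 \<le> (real k)\<^sup>2 - v" using sv by (simp add: zero_le_mult_iff)
  then have "s * ((real k)\<^sup>2 - v) \<le> v * ((real k)\<^sup>2 - v)" using sv by (intro mult_right_mono) auto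
  then have "v * (real k - 1) \<le> v * ((real k)\<^sup>2 - v)" using main by (simp add: mult.commute)
  then have "real k - 1 \<le> (real k)\<^sup>2 - v" using sv by simp
  then have "real (card P + k) \<le> real (k\<^sup>2 + 1)" by (simp add: v_def)
  then show "card P + k \<le> k\<^sup>2 + 1" by linarith
  assume eq: "card P + k = k\<^sup>2 + 1" and k2: "k \<ge> 2"
  then have "real (card P + k) = real (k\<^sup>2 + 1)" by simp
  then have veq: "(real k)\<^sup>2 - v = real k - 1" by (simp add: v_def)
  have "(real k - 1) * v \<le> (real k - 1) * s" using main unfolding veq by (simp add: mult.commute)
  then have "v \<le> s" using k2 by simp
  then have vs: "s = v" using sv by simp
  have "real k * (\<Sum>m\<in>S. e m) = 0" using total unfolding veq vs by simp
  then have "(\<Sum>m\<in>S. e m) = 0" using k2 by simp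
  then have ez: "e m = 0" if "m \<in> S" for m
    using sum_nonneg_eq_0_iff[OF fin, of e] e0 that by simp
  have one: "card (m \<inter> l) = 1" if "m \<in> S" "l \<in> S" "l \<noteq> m" for m l
  proof -
    have "\<forall>l\<in>S - {m}. u l * (real (card (m \<inter> l)) - 1) = 0"
      using ez[OF that(1)] term0[OF that(1)] fin unfolding e_def
      by (subst (asm) sum_nonneg_eq_0_iff) auto
    then have "u l * (real (card (m \<inter> l)) - 1) = 0" using that by simp
    then show ?thesis using pos[OF that(2)] by simp
  qed
  have weight: "u m = 1 / k" if "m \<in> S" for m
  proof -
    have "k * ((real k - 1) * u m) = (real k)\<^sup>2 - k * t"
      using e[OF that] ez[OF that] by (simp add: power2_eq_square flip: right_diff_distrib)
    then have "(real k - 1) * (k * u m) = (real k - 1) * 1" using kt veq by (simp add: algebra_simps)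
    then have "k * u m = 1" using k2 by (subst (asm) mult_left_cancel) auto
    then show ?thesis using k2 by (simp add: field_simps)
  qed
  have "card {l \<in> S. p \<in> l} = k" if "p \<in> P" for p
  proof -
    have "1 = (\<Sum>l | l \<in> S \<and> p \<in> l. u l)" using u that by (simp add: perfect_fractional_matching_def)
    also have "\<dots> = card {l \<in> S. p \<in> l} / k" using weight by simp
    finally show ?thesis using k2 by simp
  qed
  then show "\<exists>S\<subseteq>L. card S = card P \<and> (\<forall>p\<in>P. card {l \<in> S. p \<in> l} = k) \<and>
        (\<forall>l\<in>S. \<forall>m\<in>S. l \<noteq> m \<longrightarrow> card (l \<inter> m) = 1)"
    using \<open>S \<subseteq> L\<close> vs one by (intro exI[of _ S]) (auto simp: s_def v_def)
qed

section \<open>Projective planes\<close>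

text \<open>Two lines with two common points coincide, so the \<open>k\<close> lines through a point \<open>p\<close> cover
  \<open>k (k - 1)\<close> points other than \<open>p\<close>. This is the number of all points other than \<open>p\<close>; hence every
  point is joined to \<open>p\<close>.\<close>

lemma projective_plane_of_dual:
  fixes k :: nat
  assumes "finite P" "finite S" "k \<ge> 2"
    and cardP: "card P = k\<^sup>2 - k + 1" and cardS: "card S = k\<^sup>2 - k + 1"
    and unif: "\<And>l. l \<in> S \<Longrightarrow> l \<subseteq> P \<and> card l = k"
    and deg: "\<And>p. p \<in> P \<Longrightarrow> card {l \<in> S. p \<in> l} = k"
    and meet: "\<And>l m. l \<in> S \<Longrightarrow> m \<in> S \<Longrightarrow> l \<noteq> m \<Longrightarrow> card (l \<inter> m) = 1"
  shows "projective_plane P S"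
proof -
  have uniq: "l = m" if "l \<in> S" "m \<in> S" "p \<noteq> q" "p \<in> l" "q \<in> l" "p \<in> m" "q \<in> m" for l m p q
  proof (rule ccontr)
    assume "l \<noteq> m"
    then have "card (l \<inter> m) = 1" using meet that(1,2) by blast
    then obtain x where "l \<inter> m = {x}" by (rule card_1_singletonE)
    then have "p = x" "q = x" using that(4-7) by (metis IntI singletonD)+
    then show False using \<open>p \<noteq> q\<close> by simp
  qed
  have "\<exists>l\<in>S. p \<in> l \<and> q \<in> l" if "p \<in> P" "q \<in> P" "p \<noteq> q" for p q
  proof -
    let ?N = "{l \<in> S. p \<in> l}"
    have fin: "finite l" if "l \<in> S" for l using unif[OF that] \<open>finite P\<close> finite_subset by blast
    have disj: "(l - {p}) \<inter> (m - {p}) = {}" if "l \<in> ?N" "m \<in> ?N" "l \<noteq> m" for l m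
    proof (rule ccontr)
      assume "(l - {p}) \<inter> (m - {p}) \<noteq> {}"
      then obtain y where "y \<in> l" "y \<in> m" "p \<noteq> y" by blast
      then show False using uniq[of l m p y] \<open>l \<in> ?N\<close> \<open>m \<in> ?N\<close> \<open>l \<noteq> m\<close> by simp
    qed
    have "card (\<Union>l\<in>?N. l - {p}) = (\<Sum>l\<in>?N. card (l - {p}))"
      using assms(2) fin disj by (intro card_UN_disjoint) simp_all
    also have "\<dots> = k * (k - 1)"
      using fin unif deg[OF \<open>p \<in> P\<close>] by simp
    also have "\<dots> = card (P - {p})"
      using cardP \<open>p \<in> P\<close> \<open>finite P\<close> by (simp add: power2_eq_square diff_mult_distrib2)
    finally have "(\<Union>l\<in>?N. l - {p}) = P - {p}"
      using unif \<open>finite P\<close> by (intro card_subset_eq) auto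
    then have "q \<in> (\<Union>l\<in>?N. l - {p})" using that by simp
    then show ?thesis by blast
  qed
  then have "\<forall>p\<in>P. \<forall>q\<in>P. p \<noteq> q \<longrightarrow> (\<exists>!l. l \<in> S \<and> p \<in> l \<and> q \<in> l)"
    using uniq by (metis (no_types, lifting))
  then show ?thesis
    unfolding projective_plane_def using assms(1-3) cardP cardS unif
    by (intro conjI exI[of _ k]) simp_all
qed

text \<open>Let \<open>l\<close> be the line through two points \<open>p, q\<close> of \<open>m\<close>. If \<open>l\<close> had a point \<open>x\<close> outside \<open>m\<close>, then
  the \<open>k\<close> lines through \<open>x\<close> would meet \<open>m\<close> in disjoint nonempty sets, and so each of them in exactly one
  of the \<open>k\<close> points of \<open>m\<close>; but \<open>l\<close> contains both \<open>p\<close> and \<open>q\<close>.\<close>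

lemma blocking_set_is_line:
  fixes k :: nat
  assumes plane: "projective_plane P S" and "k \<ge> 2"
    and unif: "\<And>l. l \<in> S \<Longrightarrow> card l = k"
    and deg: "\<And>p. p \<in> P \<Longrightarrow> card {l \<in> S. p \<in> l} = k"
    and m: "m \<subseteq> P" "card m = k"
    and meet: "\<And>l. l \<in> S \<Longrightarrow> m \<inter> l \<noteq> {}"
  shows "m \<in> S"
proof -
  have finP: "finite P" and sub: "\<And>l. l \<in> S \<Longrightarrow> l \<subseteq> P"
    and line: "\<And>p q. p \<in> P \<Longrightarrow> q \<in> P \<Longrightarrow> p \<noteq> q \<Longrightarrow> \<exists>!l. l \<in> S \<and> p \<in> l \<and> q \<in> l"
    using plane by (auto simp: projective_plane_def)
  have finm: "finite m" using m finP finite_subset by blast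
  obtain p q where pq: "p \<in> m" "q \<in> m" "p \<noteq> q"
  proof -
    have "\<not> m \<subseteq> {p}" for p using card_mono[of "{p}" m] m \<open>k \<ge> 2\<close> by auto
    then show ?thesis using that by (metis insertI1 subsetI singletonD)
  qed
  then obtain l where l: "l \<in> S" "p \<in> l" "q \<in> l" using line[of p q] m by blast
  have "l \<subseteq> m"
  proof
    fix x assume "x \<in> l"
    show "x \<in> m"
    proof (rule ccontr)
      assume "x \<notin> m"
      have "x \<in> P" using \<open>x \<in> l\<close> l sub by blast
      define N where "N = {n \<in> S. x \<in> n}"
      have "\<forall>n\<in>N. \<exists>y. y \<in> m \<inter> n" using meet by (auto simp: N_def)
      then obtain g where g: "\<And>n. n \<in> N \<Longrightarrow> g n \<in> m \<inter> n" by metis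
      have same: "n = n'" if "n \<in> N" "n' \<in> N" "y \<in> n" "y \<in> n'" "y \<in> m" for n n' y
        using line[of x y] \<open>x \<in> P\<close> that m \<open>x \<notin> m\<close> unfolding N_def by blast
      have "inj_on g N" using same g by (intro inj_onI) (metis IntE)
      then have "card (g ` N) = card m" using deg[OF \<open>x \<in> P\<close>] m by (simp add: card_image N_def)
      then have "g ` N = m" using g finm by (intro card_subset_eq) auto
      then obtain n n' where n: "n \<in> N" "g n = p" "n' \<in> N" "g n' = q" using pq by (metis imageE)
      have "l \<in> N" using l \<open>x \<in> l\<close> by (simp add: N_def)
      then have "n = l" "n' = l" using same[of n l p] same[of n' l q] n g l pq by blast+
      then show False using n pq by simp
    qed
  qed
  then have "l = m" using finm m unif[OF l(1)] by (intro card_subset_eq) auto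
  then show ?thesis using l by simp
qed

text \<open>The plane found by the bound lives on a subfamily \<open>S\<close>. All members of \<open>L\<close> meet those of \<open>S\<close>, so they are
  lines of that plane and \<open>L = S\<close>.\<close>

lemma intersecting_family_extremal:
  fixes k :: nat
  assumes finP: "finite P" and finL: "finite L"
    and unif: "\<And>l. l \<in> L \<Longrightarrow> l \<subseteq> P \<and> card l = k"
    and meet: "\<And>l m. l \<in> L \<Longrightarrow> m \<in> L \<Longrightarrow> l \<inter> m \<noteq> {}"
    and w: "perfect_fractional_matching P L w"
    and eq: "card P + k = k\<^sup>2 + 1" and k: "k \<ge> 2"
  shows "projective_plane P L"
proof -
  have cardP: "card P = k\<^sup>2 - k + 1" using eq self_le_power[of k 2] k by simp
  then have "P \<noteq> {}" by auto
  from intersecting_family_bound(2)[OF finP finL this unif meet w eq k]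
  obtain S where "S \<subseteq> L" and S: "card S = card P"
      "\<And>p. p \<in> P \<Longrightarrow> card {l \<in> S. p \<in> l} = k"
      "\<And>l m. l \<in> S \<Longrightarrow> m \<in> S \<Longrightarrow> l \<noteq> m \<Longrightarrow> card (l \<inter> m) = 1"
    by auto
  have uS: "l \<subseteq> P \<and> card l = k" if "l \<in> S" for l using unif that \<open>S \<subseteq> L\<close> by blast
  have plane: "projective_plane P S"
    using S(1) cardP finite_subset[OF \<open>S \<subseteq> L\<close> finL]
    by (intro projective_plane_of_dual[OF finP _ k cardP _ uS S(2,3)]) simp_all
  have "m \<in> S" if "m \<in> L" for m
  proof (rule blocking_set_is_line[OF plane k _ S(2)])
    show "m \<inter> l \<noteq> {}" if "l \<in> S" for l using meet[OF \<open>m \<in> L\<close>] that \<open>S \<subseteq> L\<close> by blast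
  qed (use uS unif[OF that] in auto)
  then have "L = S" using \<open>S \<subseteq> L\<close> by blast
  then show ?thesis using plane by simp
qed

section \<open>Translates of a subgroup orbit\<close>

context group_action
begin

lemma action_closed: "\<lbrakk>g \<in> carrier G; y \<in> E\<rbrakk> \<Longrightarrow> \<phi> g y \<in> E"
  using surj_prop by blast

lemma mult_image:
  assumes "Y \<subseteq> E" "g \<in> carrier G" "h \<in> carrier G"
  shows "\<phi> (g \<otimes> h) ` Y = \<phi> g ` (\<phi> h ` Y)"
  using assms composition_rule by (force simp: image_image)

lemma inv_cancel:
  assumes "y \<in> E" "g \<in> carrier G"
  shows "\<phi> (inv g) (\<phi> g y) = y" "\<phi> g (\<phi> (inv g) y) = y"
proof -
  interpret group G using group_hom group_hom.axioms(1) by auto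
  show "\<phi> (inv g) (\<phi> g y) = y" using orbit_sym_aux[OF assms(2,1)] by simp
  show "\<phi> g (\<phi> (inv g) y) = y" using orbit_sym_aux[of "inv g" y] assms by simp
qed

definition translates :: "'c set \<Rightarrow> 'c set set" where
  "translates Y = (\<lambda>g. \<phi> g ` Y) ` carrier G"

lemma translates_closed:
  assumes "Y \<subseteq> E" "l \<in> translates Y" "g \<in> carrier G"
  shows "\<phi> g ` l \<in> translates Y"
proof -
  interpret group G using group_hom group_hom.axioms(1) by auto
  show ?thesis using assms by (auto simp: translates_def mult_image[symmetric])
qed

lemma translates_subset:
  assumes "Y \<subseteq> E" "l \<in> translates Y"
  shows "l \<subseteq> E" "card l = card Y"
proof -
  obtain g where g: "g \<in> carrier G" "l = \<phi> g ` Y" using assms(2) by (auto simp: translates_def)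
  then show "l \<subseteq> E" using assms surj_prop by blast
  show "card l = card Y" using g assms inj_prop by (metis card_image inj_on_subset)
qed

text \<open>The action permutes the translates injectively. Applied in both directions between two points, the
  inequality shows that in a transitive action all points lie in equally many translates.\<close>

lemma translates_degree_le:
  assumes "finite (carrier G)" "Y \<subseteq> E" "p \<in> E" "g \<in> carrier G"
  shows "card {l \<in> translates Y. p \<in> l} \<le> card {l \<in> translates Y. \<phi> g p \<in> l}"
proof (rule card_inj_on_le)
  show "inj_on ((`) (\<phi> g)) {l \<in> translates Y. p \<in> l}"
    using inj_prop[OF assms(4)] translates_subset[OF assms(2)]
    by (intro inj_onI) (metis (no_types, lifting) inj_on_image_eq_iff mem_Collect_eq)
  show "(`) (\<phi> g) ` {l \<in> translates Y. p \<in> l} \<subseteq> {l \<in> translates Y. \<phi> g p \<in> l}"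
    using translates_closed[OF assms(2) _ assms(4)] by auto
  show "finite {l \<in> translates Y. \<phi> g p \<in> l}"
    using assms(1) by (simp add: translates_def)
qed

end

lemma (in transitive_action) translates_perfect_fractional_matching:
  assumes "finite (carrier G)" "Y \<subseteq> E" "Y \<noteq> {}"
  shows "\<exists>w. perfect_fractional_matching E (translates Y) w"
proof -
  interpret group G using group_hom group_hom.axioms(1) by auto
  obtain y where "y \<in> Y" using assms by blast
  then have "y \<in> E" using assms by blast
  define r where "r = card {l \<in> translates Y. y \<in> l}"
  have deg: "card {l \<in> translates Y. p \<in> l} = r" if p: "p \<in> E" for p
  proof (rule antisym)
    obtain g where g: "g \<in> carrier G" "\<phi> g p = y" using unique_orbit[OF p \<open>y \<in> E\<close>] by blast
    show "card {l \<in> translates Y. p \<in> l} \<le> r"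
      using translates_degree_le[OF assms(1,2) p g(1)] g by (simp add: r_def)
    obtain h where h: "h \<in> carrier G" "\<phi> h y = p" using unique_orbit[OF \<open>y \<in> E\<close> p] by blast
    show "r \<le> card {l \<in> translates Y. p \<in> l}"
      using translates_degree_le[OF assms(1,2) \<open>y \<in> E\<close> h(1)] h by (simp add: r_def)
  qed
  have "y \<in> \<phi> \<one> ` Y"
    using \<open>y \<in> Y\<close> \<open>y \<in> E\<close> id_eq_one by (metis image_eqI restrict_apply')
  then have "{l \<in> translates Y. y \<in> l} \<noteq> {}" by (auto simp: translates_def)
  then have "r > 0" using assms(1) by (simp add: r_def card_gt_0_iff translates_def)
  then have "perfect_fractional_matching E (translates Y) (\<lambda>_. 1 / r)"
    using deg by (simp add: perfect_fractional_matching_def)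
  then show ?thesis by blast
qed

text \<open>A triple factorisation seen from an abstract transitive action, the second factor being a point
  stabilizer. The right cosets of \<open>B\<close> are an instance: the point \<open>B\<close> has stabilizer \<open>B\<close>.\<close>

locale factorised_action = transitive_action +
  fixes A x
  assumes finite_group: "finite (carrier G)"
    and subgroup_A: "subgroup A G"
    and point: "x \<in> E"
    and factorisation: "carrier G \<subseteq> {a \<otimes> b \<otimes> c | a b c. a \<in> A \<and> b \<in> stabilizer G \<phi> x \<and> c \<in> A}"
begin

sublocale group G using group_hom group_hom.axioms(1) by auto

definition A_orbit :: "'c set" where
  "A_orbit = (\<lambda>a. \<phi> a x) ` A"

lemma A_carrier: "a \<in> A \<Longrightarrow> a \<in> carrier G"
  using subgroup.mem_carrier[OF subgroup_A] .

lemma A_orbit_subset: "A_orbit \<subseteq> E"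
  using action_closed[OF A_carrier point] by (auto simp: A_orbit_def)

lemma A_orbit_invariant:
  assumes "a \<in> A"
  shows "\<phi> a ` A_orbit = A_orbit"
proof -
  have sub: "\<phi> c ` A_orbit \<subseteq> A_orbit" if "c \<in> A" for c
    using that subgroup.m_closed[OF subgroup_A that]
    by (auto simp: A_orbit_def A_carrier simp flip: composition_rule[OF point])
  have "A_orbit = \<phi> a ` \<phi> (inv a) ` A_orbit"
    using inv_cancel(2)[OF _ A_carrier[OF assms]] A_orbit_subset by (force simp: image_image)
  also have "\<dots> \<subseteq> \<phi> a ` A_orbit"
    using sub subgroup.m_inv_closed[OF subgroup_A assms] by blast
  finally show ?thesis using sub[OF assms] by blast
qed

lemma A_orbit_in_translates: "A_orbit \<in> translates A_orbit"
  using A_orbit_invariant[OF subgroup.one_closed[OF subgroup_A]]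
  by (auto simp: translates_def intro!: image_eqI[of _ _ \<one>])

text \<open>The factorisation of \<open>g\<^sup>-\<^sup>1h\<close> as \<open>abc\<close>, with \<open>b\<close> fixing \<open>x\<close>, gives the common point
  \<open>hc\<^sup>-\<^sup>1x = gabx = gax\<close> of the two translates.\<close>

lemma translates_meet:
  assumes "l \<in> translates A_orbit" "m \<in> translates A_orbit"
  shows "l \<inter> m \<noteq> {}"
proof -
  obtain g h where g: "g \<in> carrier G" "l = \<phi> g ` A_orbit" and h: "h \<in> carrier G" "m = \<phi> h ` A_orbit"
    using assms by (auto simp: translates_def)
  have "inv g \<otimes> h \<in> carrier G" using g h by simp
  then obtain a b c where abc: "inv g \<otimes> h = a \<otimes> b \<otimes> c" "a \<in> A" "b \<in> stabilizer G \<phi> x" "c \<in> A"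
    using factorisation by blast
  have carr: "a \<in> carrier G" "b \<in> carrier G" "c \<in> carrier G" and b: "\<phi> b x = x"
    using abc A_carrier by (auto simp: stabilizer_def)
  have "inv g \<otimes> h \<otimes> inv c = a \<otimes> b" using carr abc(1) by (simp add: m_assoc)
  then have "h \<otimes> inv c = g \<otimes> (a \<otimes> b)" using carr g h by (metis inv_closed m_assoc m_closed inv_solve_left)
  then have "\<phi> h (\<phi> (inv c) x) = \<phi> g (\<phi> a (\<phi> b x))"
    using carr g h point by (metis composition_rule inv_closed m_closed action_closed)
  moreover have "inv c \<in> A" using abc subgroup.m_inv_closed[OF subgroup_A] by blast
  ultimately show ?thesis using g h b abc by (force simp: A_orbit_def)
qed

lemma finite_points: "finite E"
proof -
  have "E \<subseteq> (\<lambda>g. \<phi> g x) ` carrier G" using unique_orbit[OF point] by blast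
  then show ?thesis using finite_group finite_subset by blast
qed

lemma A_orbit_nonempty: "A_orbit \<noteq> {}"
  using subgroup.one_closed[OF subgroup_A] by (auto simp: A_orbit_def)

lemma points_bound: "card E + card A_orbit \<le> (card A_orbit)\<^sup>2 + 1"
proof -
  obtain w where "perfect_fractional_matching E (translates A_orbit) w"
    using translates_perfect_fractional_matching[OF finite_group A_orbit_subset A_orbit_nonempty] by blast
  then show ?thesis
    using point translates_subset[OF A_orbit_subset] translates_meet finite_group
    by (intro intersecting_family_bound(1)[OF finite_points]) (auto simp: translates_def)
qed

lemma points_extremal:
  assumes "card E + card A_orbit = (card A_orbit)\<^sup>2 + 1" "card A_orbit \<ge> 2"
  shows "projective_plane E (translates A_orbit)"
proof -
  obtain w where "perfect_fractional_matching E (translates A_orbit) w"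
    using translates_perfect_fractional_matching[OF finite_group A_orbit_subset A_orbit_nonempty] by blast
  then show ?thesis
    using translates_subset[OF A_orbit_subset] translates_meet finite_group
    by (intro intersecting_family_extremal[OF finite_points _ _ _ _ assms]) (auto simp: translates_def)
qed

text \<open>A flag is a translate \<open>g\<Delta>\<close> with a point \<open>gax\<close>, where \<open>\<Delta>\<close> is the orbit of \<open>x\<close> under \<open>A\<close>. The
  element \<open>h(ca\<^sup>-\<^sup>1)g\<^sup>-\<^sup>1\<close> maps it to the flag of \<open>h\<Delta>\<close> and \<open>hcx\<close>, since \<open>ca\<^sup>-\<^sup>1 \<in> A\<close> fixes \<open>\<Delta>\<close>.\<close>

lemma flag_transitive_translates:
  "flag_transitive_collineation_group G \<phi> E (translates A_orbit)"
proof -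
  have "\<exists>f\<in>carrier G. \<phi> f p = q \<and> \<phi> f ` l = m"
    if lm: "l \<in> translates A_orbit" "m \<in> translates A_orbit" "p \<in> l" "q \<in> m" for p q l m
  proof -
    obtain g h where g: "g \<in> carrier G" "l = \<phi> g ` A_orbit" and h: "h \<in> carrier G" "m = \<phi> h ` A_orbit"
      using lm(1,2) by (auto simp: translates_def)
    obtain a c where a: "a \<in> A" "p = \<phi> g (\<phi> a x)" and c: "c \<in> A" "q = \<phi> h (\<phi> c x)"
      using lm(3,4) unfolding g(2) h(2) A_orbit_def by blast
    have carr: "a \<in> carrier G" "c \<in> carrier G" using a c A_carrier by auto
    define d where "d = c \<otimes> inv a"
    have d: "d \<in> A" "d \<in> carrier G"
      using a c subgroup.m_closed[OF subgroup_A] subgroup.m_inv_closed[OF subgroup_A] A_carrier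
      by (auto simp: d_def)
    let ?f = "h \<otimes> d \<otimes> inv g"
    have f: "\<phi> ?f y = \<phi> h (\<phi> d (\<phi> (inv g) y))" if "y \<in> E" for y
      using that g h d by (simp add: composition_rule action_closed)
    have ax: "\<phi> a x \<in> E" using action_closed[OF carr(1) point] .
    have "p \<in> E" using ax g a action_closed by simp
    then have "\<phi> ?f p = \<phi> h (\<phi> d (\<phi> a x))" using f inv_cancel(1)[OF ax g(1)] a by simp
    also have "\<phi> d (\<phi> a x) = \<phi> c x"
      using carr ax inv_cancel(1)[OF point carr(1)] by (simp add: d_def composition_rule)
    finally have "\<phi> ?f p = q" using c by simp
    moreover have "\<phi> ?f ` l = m"
    proof -
      have "\<phi> ?f ` l = (\<lambda>y. \<phi> h (\<phi> d y)) ` A_orbit"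
        unfolding g(2) image_image
        using f inv_cancel(1)[OF _ g(1)] A_orbit_subset action_closed[OF g(1)] by (intro image_cong) (auto simp: subset_iff)
      also have "\<dots> = \<phi> h ` (\<phi> d ` A_orbit)" by (simp add: image_image)
      finally show ?thesis using A_orbit_invariant[OF d(1)] h by simp
    qed
    moreover have "?f \<in> carrier G" using g h d by simp
    ultimately show ?thesis by blast
  qed
  then show ?thesis
    using translates_closed[OF A_orbit_subset] group_action_axioms
    by (simp add: flag_transitive_collineation_group_def collineation_group_def)
qed

lemma A_orbit_card: "card A_orbit * card (A \<inter> stabilizer G \<phi> x) = card A"
proof -
  have act: "group_action (G\<lparr>carrier := A\<rparr>) E \<phi>"
    using induced_action[OF subgroup_A] .
  have "orbit (G\<lparr>carrier := A\<rparr>) \<phi> x = A_orbit" by (auto simp: orbit_def A_orbit_def)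
  moreover have "stabilizer (G\<lparr>carrier := A\<rparr>) \<phi> x = A \<inter> stabilizer G \<phi> x"
    using A_carrier by (auto simp: stabilizer_def)
  ultimately show ?thesis
    using group_action.orbit_stabilizer_theorem[OF act point] by (simp add: order_def)
qed

end

section \<open>The coset action of a triple factorisation\<close>

lemma (in group) right_mult_action_coset:
  assumes "subgroup B G" "g \<in> carrier G"
  shows "right_mult_action G B g B = B #> inv g"
  using assms coset_join2[of \<one> B] subgroup.one_closed[of B G]
  by (auto simp: right_mult_action_def RCOSETS_def)

lemma (in group) right_mult_action_stabilizer:
  assumes B: "subgroup B G"
  shows "stabilizer G (right_mult_action G B) B = B"
proof -
  have "B #> inv g = B \<longleftrightarrow> g \<in> B" if "g \<in> carrier G" for g
    using that B coset_join1[of B "inv g"] coset_join2[of "inv g" B] subgroup.m_inv_closed[OF B]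
    by (metis inv_closed inv_inv)
  then show ?thesis
    using right_mult_action_coset[OF B] subgroup.mem_carrier[OF B] by (auto simp: stabilizer_def)
qed

lemma (in group) transitive_right_mult_action:
  assumes B: "subgroup B G"
  shows "transitive_action G (rcosets B) (right_mult_action G B)"
proof -
  interpret group_action G "rcosets B" "right_mult_action G B"
    using group_action_right_mult_action[OF is_group B] .
  have "\<exists>g\<in>carrier G. right_mult_action G B g X = Y" if XY: "X \<in> rcosets B" "Y \<in> rcosets B" for X Y
  proof -
    obtain g h where g: "g \<in> carrier G" "X = B #> g" and h: "h \<in> carrier G" "Y = B #> h"
      using XY by (auto simp: RCOSETS_def)
    \<comment> \<open>The action multiplies by inverses, so \<open>h\<^sup>-\<^sup>1g\<close> moves \<open>Bg\<close> to \<open>Bgg\<^sup>-\<^sup>1h = Bh\<close>.\<close>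
    have "right_mult_action G B (inv h \<otimes> g) X = (B #> g) #> (inv g \<otimes> h)"
      using XY g h by (simp add: right_mult_action_def inv_mult_group)
    also have "\<dots> = Y"
      using g h subgroup.subset[OF B] by (simp add: coset_mult_assoc m_assoc[symmetric])
    finally show ?thesis using g h by blast
  qed
  then show ?thesis by unfold_locales
qed

theorem theorem1p1:
  fixes G :: "('a, 'b) monoid_scheme" (structure) and A B :: "'a set"
  assumes "group G" and "finite (carrier G)"
    and "nontrivial_triple_factorisation G A B"
  shows "real (card (carrier G)) \<le>
           (real (card A))\<^sup>2 * real (card B) / (real (card (A \<inter> B)))\<^sup>2
           - real (card A) * real (card B) / real (card (A \<inter> B)) + real (card B)
       \<and> (real (card (carrier G)) =
           (real (card A))\<^sup>2 * real (card B) / (real (card (A \<inter> B)))\<^sup>2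
           - real (card A) * real (card B) / real (card (A \<inter> B)) + real (card B)
          \<longleftrightarrow>
          (\<exists>L. projective_plane (rcosets B) L
             \<and> {B #> a | a. a \<in> A} \<in> L
             \<and> flag_transitive_collineation_group G (right_mult_action G B) (rcosets B) L))"
proof -
  interpret group G by fact
  have A: "subgroup A G" and B: "subgroup B G" and "B \<noteq> carrier G"
    and ABA: "carrier G = {a \<otimes> b \<otimes> c | a b c. a \<in> A \<and> b \<in> B \<and> c \<in> A}"
    using assms(3) by (auto simp: nontrivial_triple_factorisation_def triple_factorisation_def)
  have finA: "finite A" and finB: "finite B"
    using subgroup.subset[OF A] subgroup.subset[OF B] assms(2) finite_subset by blast+
  interpret transitive_action G "rcosets B" "right_mult_action G B"
    by (rule transitive_right_mult_action[OF B])
  have "B \<in> rcosets B" using subgroup.subgroup_in_rcosets[OF B is_group] .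
  then interpret factorised_action G "rcosets B" "right_mult_action G B" A B
    using assms(2) A equalityD1[OF ABA]
    by (intro factorised_action.intro transitive_action_axioms factorised_action_axioms.intro)
      (simp_all only: right_mult_action_stabilizer[OF B])
  have A_orbit_eq: "A_orbit = {B #> a | a. a \<in> A}"
  proof -
    have "A_orbit = (\<lambda>a. B #> inv a) ` A"
      unfolding A_orbit_def using right_mult_action_coset[OF B A_carrier] by simp
    also have "\<dots> = (\<lambda>a. B #> a) ` (\<lambda>a. inv a) ` A" by (simp add: image_image)
    also have "(\<lambda>a. inv a) ` A = A"
      using subgroup.m_inv_closed[OF A] A_carrier by (force simp: image_iff intro: inv_inv[symmetric])
    finally show ?thesis by blast
  qed
  define k d b v where "k = card A_orbit" and "d = card (A \<inter> B)" and "b = card B"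
    and "v = card (rcosets B)"
  have "\<one> \<in> A \<inter> B" using subgroup.one_closed A B by blast
  then have d0: "d > 0" and b0: "b > 0" using finA finB by (auto simp: d_def b_def card_gt_0_iff)
  have cardA: "card A = k * d"
    using A_orbit_card right_mult_action_stabilizer[OF B] by (simp add: k_def d_def)
  have cardG: "card (carrier G) = v * b"
    using lagrange[OF B] by (simp add: v_def b_def order_def)
  have fin_orbit: "finite A_orbit" using finA by (simp add: A_orbit_def)
  then have k0: "k > 0" using A_orbit_nonempty by (simp add: k_def card_gt_0_iff)
  \<comment> \<open>If the \<open>A\<close>-orbit were a single point, then \<open>A \<subseteq> B\<close> and \<open>ABA = B\<close>, contrary to nontriviality.\<close>
  have k2: "k \<ge> 2"
  proof (rule ccontr)
    assume "\<not> k \<ge> 2"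
    then have "card A = card (A \<inter> B)" using k0 cardA by (simp add: d_def)
    then have "A \<inter> B = A" using finA by (intro card_subset_eq) auto
    then have "A \<subseteq> B" by blast
    then have "carrier G \<subseteq> B" unfolding ABA using subgroup.m_closed[OF B] by blast
    then show False using \<open>B \<noteq> carrier G\<close> subgroup.subset[OF B] by blast
  qed
  have bound: "v + k \<le> k\<^sup>2 + 1" using points_bound by (simp add: v_def k_def)
  have rhs: "(real (card A))\<^sup>2 * real (card B) / (real (card (A \<inter> B)))\<^sup>2
           - real (card A) * real (card B) / real (card (A \<inter> B)) + real (card B)
       = (real (k\<^sup>2 + 1) - real k) * real b"
    using d0 by (simp add: cardA flip: d_def b_def) (simp add: field_simps power2_eq_square)
  have lhs: "real (card (carrier G)) = (real (v + k) - real k) * real b" by (simp add: cardG)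
  have eq_iff: "real (card (carrier G)) = (real (k\<^sup>2 + 1) - real k) * real b \<longleftrightarrow> v + k = k\<^sup>2 + 1"
    unfolding lhs using b0 by (simp del: of_nat_add of_nat_power of_nat_Suc)
  have "v + k = k\<^sup>2 + 1 \<longleftrightarrow> (\<exists>L. projective_plane (rcosets B) L
             \<and> {B #> a | a. a \<in> A} \<in> L
             \<and> flag_transitive_collineation_group G (right_mult_action G B) (rcosets B) L)"
  proof
    assume "v + k = k\<^sup>2 + 1"
    then have "projective_plane (rcosets B) (translates A_orbit)"
      using points_extremal k2 by (simp add: v_def k_def)
    then show "\<exists>L. projective_plane (rcosets B) L
             \<and> {B #> a | a. a \<in> A} \<in> L
             \<and> flag_transitive_collineation_group G (right_mult_action G B) (rcosets B) L"
      unfolding A_orbit_eq[symmetric] using A_orbit_in_translates flag_transitive_translates by blast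
  next
    assume "\<exists>L. projective_plane (rcosets B) L
             \<and> {B #> a | a. a \<in> A} \<in> L
             \<and> flag_transitive_collineation_group G (right_mult_action G B) (rcosets B) L"
    then obtain L where "projective_plane (rcosets B) L" "A_orbit \<in> L" using A_orbit_eq by auto
    then have "v = k\<^sup>2 - k + 1" by (auto simp: projective_plane_def v_def k_def)
    then show "v + k = k\<^sup>2 + 1" using self_le_power[of k 2] k0 by simp
  qed
  moreover have "real (card (carrier G)) \<le> (real (k\<^sup>2 + 1) - real k) * real b"
    unfolding lhs using bound by (intro mult_right_mono diff_right_mono) (simp_all del: of_nat_add of_nat_power)
  ultimately show ?thesis unfolding rhs eq_iff by blast
qed

end
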